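(* Let $(X,p)$ be a partial metric space and define $G_p:X\times X\times X\to[0,\infty)$ by $$G_p(x,y,z)=p(x,y)+p(y,z)+p(x,z)-p(x,x)-p(y,y)-p(z,z)\quad\text{for all } x,y,z\in X.$$ Then $(X,G_p)$ is a G-metric space which is symmetric.
   Context: Let $X$ be a non-empty set. A partial metric on $X$ is a function $p:X\times X\to[0,\infty)$ such that for all $x,y,z\in X$: (P1) $x=y$ if and only if $p(x,x)=p(x,y)=p(y,y)$; (P2) $p(x,x)\le p(x,y)$; (P3) $p(x,y)=p(y,x)$; (P4) $p(x,z)\le p(x,y)+p(y,z)-p(y,y)$. The pair $(X,p)$ is called a partial metric space. A G-metric on $X$ is a function $G:X\times X\times X\to[0,\infty)$ such that: (G1) if $x=y=z$ then $G(x,y,z)=0$; (G2) $G(x,x,y)>0$ for all $x,y\in X$ with $x\ne y$; (G3) $G(x,x,y)\le G(x,y,z)$ for all $x,y,z\in X$ with $z\ne y$; (G4) $G$ is invariant under all permutations of its three arguments; (G5) $G(x,y,z)\le G(x,a,a)+G(a,y,z)$ for all $x,y,z,a\in X$. The pair $(X,G)$ is called a G-metric space; it is called symmetric if $G(x,y,y)=G(y,x,x)$ for all $x,y\in X$. *)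

theory Defs
  imports Complex_Main
begin

text \<open>
  As for the library's \<^verbatim>\<open>Metric_space\<close>, a space is a carrier set together with a total real-valued
  function that is constrained on the carrier only; the codomain \<open>[0, \<infinity>)\<close> is expressed by the
  nonnegativity axioms.
\<close>

locale partial_metric_space =
  fixes X :: "'a set" and p :: "'a \<Rightarrow> 'a \<Rightarrow> real"
  assumes nonempty: "X \<noteq> {}"
    and nonneg: "\<lbrakk>x \<in> X; y \<in> X\<rbrakk> \<Longrightarrow> 0 \<le> p x y"
    and P1: "\<lbrakk>x \<in> X; y \<in> X\<rbrakk> \<Longrightarrow> x = y \<longleftrightarrow> p x x = p x y \<and> p x y = p y y"
    and P2: "\<lbrakk>x \<in> X; y \<in> X\<rbrakk> \<Longrightarrow> p x x \<le> p x y"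
    and P3: "\<lbrakk>x \<in> X; y \<in> X\<rbrakk> \<Longrightarrow> p x y = p y x"
    and P4: "\<lbrakk>x \<in> X; y \<in> X; z \<in> X\<rbrakk> \<Longrightarrow> p x z \<le> p x y + p y z - p y y"

locale G_metric_space =
  fixes X :: "'a set" and G :: "'a \<Rightarrow> 'a \<Rightarrow> 'a \<Rightarrow> real"
  assumes nonempty: "X \<noteq> {}"
    and nonneg: "\<lbrakk>x \<in> X; y \<in> X; z \<in> X\<rbrakk> \<Longrightarrow> 0 \<le> G x y z"
    and G1: "\<lbrakk>x \<in> X; y \<in> X; z \<in> X; x = y; y = z\<rbrakk> \<Longrightarrow> G x y z = 0"
    and G2: "\<lbrakk>x \<in> X; y \<in> X; x \<noteq> y\<rbrakk> \<Longrightarrow> 0 < G x x y"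
    and G3: "\<lbrakk>x \<in> X; y \<in> X; z \<in> X; z \<noteq> y\<rbrakk> \<Longrightarrow> G x x y \<le> G x y z"
    and G4: "\<lbrakk>x \<in> X; y \<in> X; z \<in> X\<rbrakk> \<Longrightarrow>
      G x y z = G x z y \<and> G x y z = G y x z \<and> G x y z = G y z x \<and>
      G x y z = G z x y \<and> G x y z = G z y x"
    and G5: "\<lbrakk>x \<in> X; y \<in> X; z \<in> X; a \<in> X\<rbrakk> \<Longrightarrow> G x y z \<le> G x a a + G a y z"

locale symmetric_G_metric_space = G_metric_space +
  assumes symmetric: "\<lbrakk>x \<in> X; y \<in> X\<rbrakk> \<Longrightarrow> G x y y = G y x x"

definition G_of_partial_metric :: "('a \<Rightarrow> 'a \<Rightarrow> real) \<Rightarrow> 'a \<Rightarrow> 'a \<Rightarrow> 'a \<Rightarrow> real" where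
  "G_of_partial_metric p x y z = p x y + p y z + p x z - p x x - p y y - p z z"

end

theory Submission imports Defs begin

text \<open>With \<open>d x y = 2 * p x y - p x x - p y y\<close>, the metric induced by
  \<open>p\<close>, \<open>G_of_partial_metric p x y z\<close> is half the perimeter
  \<open>(d x y + d y z + d x z) / 2\<close>, and its value at \<open>x x y\<close> is
  \<open>d x y\<close>. The axioms thus reduce to positivity, symmetry and the triangle inequality
  for \<open>d\<close>, which come from P1 with P2, P3 and P4.\<close>

theorem proposition2p3:
  fixes X :: "'a set" and p :: "'a \<Rightarrow> 'a \<Rightarrow> real"
  assumes "partial_metric_space X p"
  shows "symmetric_G_metric_space X (G_of_partial_metric p)"
proof -
  interpret partial_metric_space X p by fact
  let ?G = "G_of_partial_metric p"
  show ?thesis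
  proof unfold_locales
    show "X \<noteq> {}" by (rule nonempty)
  next
    fix x y z assume "x \<in> X" "y \<in> X" "z \<in> X"
    then show "0 \<le> ?G x y z"
      \<comment> \<open>Going round the cycle x, y, z charges each self-distance to a different
        side.\<close>
      using P2[of x y] P2[of y z] P2[of z x] P3[of x z]
      by (simp add: G_of_partial_metric_def)
  next
    fix x y z :: 'a assume "x = y" "y = z"
    then show "?G x y z = 0"
      by (simp add: G_of_partial_metric_def)
  next
    fix x y assume "x \<in> X" "y \<in> X" "x \<noteq> y"
    then show "0 < ?G x x y"
      \<comment> \<open>The value is the sum of the gaps \<open>p x y - p x x\<close> and
        \<open>p x y - p y y\<close>, both nonnegative; by P1 they cannot both vanish.\<close>
      using P1[of x y] P2[of x y] P2[of y x] P3[of x y]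
      by (auto simp: G_of_partial_metric_def)
  next
    fix x y z assume "x \<in> X" "y \<in> X" "z \<in> X"
    then show "?G x x y \<le> ?G x y z"
      \<comment> \<open>After cancellation this is exactly P4 for the detour from x to y through
        z.\<close>
      using P4[of x z y] P3[of y z]
      by (simp add: G_of_partial_metric_def)
  next
    fix x y z assume "x \<in> X" "y \<in> X" "z \<in> X"
    then show "?G x y z = ?G x z y \<and> ?G x y z = ?G y x z \<and> ?G x y z = ?G y z x \<and>
        ?G x y z = ?G z x y \<and> ?G x y z = ?G z y x"
      using P3[of x y] P3[of y z] P3[of x z]
      by (simp add: G_of_partial_metric_def)
  next
    fix x y z a assume "x \<in> X" "y \<in> X" "z \<in> X" "a \<in> X"
    then show "?G x y z \<le> ?G x a a + ?G a y z"
      \<comment> \<open>Only the two sides at x change: each is rerouted through a, and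
        \<open>?G x a a\<close> pays for both detours.\<close>
      using P4[of x a y] P4[of x a z]
      by (simp add: G_of_partial_metric_def)
  next
    fix x y assume "x \<in> X" "y \<in> X"
    then show "?G x y y = ?G y x x"
      using P3[of x y]
      by (simp add: G_of_partial_metric_def)
  qed
qed

end
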